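(* Let $f:\mathbb{R}^n\to\mathbb{R}$ be an $L_s$-RSS and $C^1$ function. Suppose $f$ is bounded below on $C_s$ and $f$ is strictly convex on $\mathcal{S}_{\mathcal{J}}$ for any index subset $\mathcal{J}\subset\{1,\dots,n\}$ with $|\mathcal{J}|=s$. Let $\mathbf{x}^*$ be a strictly HT-stable stationary point associated with any given $\gamma\in(0,\frac{1}{L_s}]$. Then there exists a neighborhood $\mathcal{B}$ of $\mathbf{x}^*$ such that for every $\mathbf{x}^0\in\mathcal{B}\cap C_s$, the IHT sequence $(\mathbf{x}^k)_{k\ge0}$ associated with $\gamma$ starting from $\mathbf{x}^0$ converges to $\mathbf{x}^*$. Moreover, if $f$ is strongly convex on $\mathcal{S}_{\mathcal{J}}$ for every index subset $\mathcal{J}$ with $|\mathcal{J}|=s$, then for $\mathbf{x}^0\in\mathcal{B}\cap C_s$, the IHT sequence $(\mathbf{x}^k)_{k\ge0}$ converges Q-linearly to $\mathbf{x}^*$.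
   Context: Here $s,n$ are integers with $1\le s<n$, $\|\mathbf{x}\|_0$ is the number of nonzero entries of $\mathbf{x}$, and $C_s=\{\mathbf{x}\in\mathbb{R}^n\mid\|\mathbf{x}\|_0\le s\}$. For an index subset $\mathcal{J}\subset\{1,\dots,n\}$ with $|\mathcal{J}|=s$, $\mathcal{S}_{\mathcal{J}}=\{\mathbf{x}\in\mathbb{R}^n\mid\mathbf{x}_{\mathcal{J}^c}=0\}$ is the subspace of vectors supported in $\mathcal{J}$. RSS: a differentiable $f:\mathbb{R}^n\to\mathbb{R}$ is $L_s$-RSS (restricted strongly smooth with modulus $L_s>0$) if $f(\mathbf{y})\le f(\mathbf{x})+\langle\nabla f(\mathbf{x}),\mathbf{y}-\mathbf{x}\rangle+\frac{L_s}{2}\|\mathbf{y}-\mathbf{x}\|_2^2$ for all $\mathbf{x},\mathbf{y}\in C_s$. Hard thresholding operator: $H_s(\mathbf{x})=\arg\min_{\|\mathbf{z}\|_0\le s}\|\mathbf{z}-\mathbf{x}\|_2$, a set of minimizers that may contain more than one element. An IHT sequence associated with stepsize $\gamma$ starting from $\mathbf{x}^0\in C_s$ is any sequence with $\mathbf{x}^{k+1}\in H_s(\mathbf{x}^k-\gamma\nabla f(\mathbf{x}^k))$ for $k=0,1,\dots$. $\mathcal{I}^{\mathbf{x}}_s\subset\{1,\dots,n\}$ denotes a set of $s$ indices of the $s$ largest entries of $\mathbf{x}$ in absolute value; $\mathrm{supp}(\mathbf{x})$ is the set of indices of nonzero entries; $\nabla_{\mathcal{J}}f(\mathbf{x})$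 is the restriction of $\nabla f(\mathbf{x})$ to the entries indexed by $\mathcal{J}$. For $\gamma>0$, a vector $\mathbf{x}^*\in C_s$ is a strictly HT-stable stationary point associated with $\gamma$ if $\nabla_{\mathrm{supp}(\mathbf{x}^* )}f(\mathbf{x}^* )=0$ and $$\min\big(|x^*_i|: i\in\mathcal{I}^{\mathbf{x}^*}_s\big)>\gamma\max\big(|\nabla_jf(\mathbf{x}^* )|: j\notin\mathrm{supp}(\mathbf{x}^* )\big)$$ (the left side does not depend on the choice of $\mathcal{I}^{\mathbf{x}^*}_s$). *)

theory Defs
  imports "HOL-Analysis.Analysis"
begin

definition gradient :: "('a::euclidean_space \<Rightarrow> real) \<Rightarrow> 'a \<Rightarrow> 'a" where
  "gradient f x = (THE D. GDERIV f x :> D)"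

lemma gradient_eqI:
  fixes f :: "'a::euclidean_space \<Rightarrow> real"
  assumes "GDERIV f x :> D"
  shows "gradient f x = D"
  unfolding gradient_def
proof (rule the_equality)
  show "GDERIV f x :> D" by (fact assms)
  fix D' assume "GDERIV f x :> D'"
  with assms have "(\<lambda>h. h \<bullet> D') = (\<lambda>h. h \<bullet> D)"
    unfolding gderiv_def using has_derivative_unique by blast
  then have "h \<bullet> D' = h \<bullet> D" for h by meson
  then show "D' = D" by (metis vector_eq_ldot)
qed

lemma GDERIV_gradient:
  fixes f :: "'a::euclidean_space \<Rightarrow> real"
  assumes "f differentiable (at x)"
  shows "GDERIV f x :> gradient f x"
proof -
  obtain f' where f': "(f has_derivative f') (at x)"
    using assms by (auto simp: differentiable_def)
  interpret linear f' using f' by (rule has_derivative_linear)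
  have "f' = (\<lambda>h. h \<bullet> adjoint f' 1)"
    using adjoint_works[OF linear_axioms] by fastforce
  with f' have "GDERIV f x :> adjoint f' 1"
    unfolding gderiv_def by metis
  then show ?thesis using gradient_eqI by metis
qed

definition C1_function :: "('a::euclidean_space \<Rightarrow> real) \<Rightarrow> bool" where
  "C1_function f \<longleftrightarrow> (\<forall>x. f differentiable (at x)) \<and> continuous_on UNIV (gradient f)"

definition supp :: "real^'n \<Rightarrow> 'n::finite set" where
  "supp x = {i. x $ i \<noteq> 0}"

definition l0norm :: "real^'n::finite \<Rightarrow> nat" where
  "l0norm x = card (supp x)"

definition sparse_set :: "nat \<Rightarrow> (real^'n::finite) set" where
  "sparse_set s = {x. l0norm x \<le> s}"

definition coord_subspace :: "'n::finite set \<Rightarrow> (real^'n) set" where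
  "coord_subspace J = {x. \<forall>i. i \<notin> J \<longrightarrow> x $ i = 0}"

definition RSS :: "nat \<Rightarrow> real \<Rightarrow> (real^'n::finite \<Rightarrow> real) \<Rightarrow> bool" where
  "RSS s L f \<longleftrightarrow> L > 0 \<and> (\<forall>x. f differentiable (at x)) \<and>
     (\<forall>x\<in>sparse_set s. \<forall>y\<in>sparse_set s.
        f y \<le> f x + gradient f x \<bullet> (y - x) + L / 2 * (norm (y - x))\<^sup>2)"

definition strictly_convex_on :: "'a::real_vector set \<Rightarrow> ('a \<Rightarrow> real) \<Rightarrow> bool" where
  "strictly_convex_on S f \<longleftrightarrow> convex S \<and>
     (\<forall>x\<in>S. \<forall>y\<in>S. \<forall>u>0. \<forall>v>0. x \<noteq> y \<longrightarrow> u + v = 1 \<longrightarrow>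
        f (u *\<^sub>R x + v *\<^sub>R y) < u * f x + v * f y)"

definition strongly_convex_on :: "'a::real_normed_vector set \<Rightarrow> ('a \<Rightarrow> real) \<Rightarrow> bool" where
  "strongly_convex_on S f \<longleftrightarrow> convex S \<and>
     (\<exists>\<mu>>0. \<forall>x\<in>S. \<forall>y\<in>S. \<forall>u\<ge>0. \<forall>v\<ge>0. u + v = 1 \<longrightarrow>
        f (u *\<^sub>R x + v *\<^sub>R y) \<le> u * f x + v * f y - \<mu> / 2 * u * v * (norm (x - y))\<^sup>2)"

definition hard_threshold :: "nat \<Rightarrow> real^'n::finite \<Rightarrow> (real^'n) set" where
  "hard_threshold s x = {z. is_arg_min (\<lambda>z. norm (z - x)) (\<lambda>z. l0norm z \<le> s) z}"

definition IHT_sequence ::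
  "nat \<Rightarrow> (real^'n::finite \<Rightarrow> real) \<Rightarrow> real \<Rightarrow> real^'n \<Rightarrow> (nat \<Rightarrow> real^'n) \<Rightarrow> bool" where
  "IHT_sequence s f \<gamma> x0 X \<longleftrightarrow> x0 \<in> sparse_set s \<and> X 0 = x0 \<and>
     (\<forall>k. X (Suc k) \<in> hard_threshold s (X k - \<gamma> *\<^sub>R gradient f (X k)))"

definition top_indices :: "nat \<Rightarrow> real^'n::finite \<Rightarrow> 'n set \<Rightarrow> bool" where
  "top_indices s x I \<longleftrightarrow> card I = s \<and> (\<forall>i\<in>I. \<forall>j. j \<notin> I \<longrightarrow> \<bar>x $ j\<bar> \<le> \<bar>x $ i\<bar>)"

lemma top_indices_exists:
  fixes x :: "real^'n::finite"
  assumes "s \<le> CARD('n)"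
  shows "\<exists>I. top_indices s x I"
  using assms
proof (induction s)
  case 0
  show ?case by (rule exI[of _ "{}"]) (simp add: top_indices_def)
next
  case (Suc s)
  then obtain I where I: "card I = s" "\<And>i j. i \<in> I \<Longrightarrow> j \<notin> I \<Longrightarrow> \<bar>x $ j\<bar> \<le> \<bar>x $ i\<bar>"
    by (auto simp: top_indices_def)
  with Suc.prems have "I \<noteq> UNIV" by auto
  then have "- I \<noteq> {}" by blast
  then obtain m where m: "m \<in> - I" "\<And>j. j \<in> - I \<Longrightarrow> \<bar>x $ j\<bar> \<le> \<bar>x $ m\<bar>"
    using Max_in[of "(\<lambda>j. \<bar>x $ j\<bar>) ` (- I)"] Max_ge[of "(\<lambda>j. \<bar>x $ j\<bar>) ` (- I)"]
    by fastforce
  have "top_indices (Suc s) x (insert m I)"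
    using I m by (auto simp: top_indices_def)
  then show ?case by blast
qed

lemma top_indices_Min_unique:
  fixes x :: "real^'n::finite"
  assumes "s \<ge> 1" "top_indices s x I" "top_indices s x J"
  shows "Min ((\<lambda>i. \<bar>x $ i\<bar>) ` I) = Min ((\<lambda>i. \<bar>x $ i\<bar>) ` J)"
proof -
  have le: "Min ((\<lambda>i. \<bar>x $ i\<bar>) ` B) \<le> Min ((\<lambda>i. \<bar>x $ i\<bar>) ` A)"
    if A: "top_indices s x A" and B: "top_indices s x B" for A B
  proof -
    have "A \<noteq> {}" using A assms(1) by (auto simp: top_indices_def)
    then obtain i where i: "i \<in> A" "Min ((\<lambda>i. \<bar>x $ i\<bar>) ` A) = \<bar>x $ i\<bar>"
      using Min_in[of "(\<lambda>i. \<bar>x $ i\<bar>) ` A"] by fastforce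
    obtain j where j: "j \<in> B" "\<bar>x $ j\<bar> \<le> \<bar>x $ i\<bar>"
    proof (cases "i \<in> B")
      case False
      then have "\<not> B \<subseteq> A"
        using A B i by (metis card_subset_eq finite_code top_indices_def)
      then obtain j where "j \<in> B" "j \<notin> A" by blast
      then show ?thesis using A i that by (auto simp: top_indices_def)
    qed (use that in auto)
    then have "Min ((\<lambda>i. \<bar>x $ i\<bar>) ` B) \<le> \<bar>x $ j\<bar>" by (intro Min_le) auto
    with i j show ?thesis by linarith
  qed
  show ?thesis using le[OF assms(2,3)] le[OF assms(3,2)] by linarith
qed

text \<open>
  The existential quantifier over \<open>I\<close> is immaterial: for \<open>1 \<le> s\<close> and \<open>s\<close> at most the dimension,
  a set of \<open>s\<close> largest entries exists (\<open>top_indices_exists\<close>) and the minimum does not depend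
  on its choice (\<open>top_indices_Min_unique\<close>).  For \<open>s\<close> below the dimension, the index set of the
  maximum is nonempty, since \<open>x\<close> has at most \<open>s\<close> nonzero entries.
\<close>

definition strictly_HT_stable ::
  "nat \<Rightarrow> (real^'n::finite \<Rightarrow> real) \<Rightarrow> real \<Rightarrow> real^'n \<Rightarrow> bool" where
  "strictly_HT_stable s f \<gamma> x \<longleftrightarrow> \<gamma> > 0 \<and> x \<in> sparse_set s \<and>
     (\<forall>i\<in>supp x. gradient f x $ i = 0) \<and>
     (\<exists>I. top_indices s x I \<and>
        Min ((\<lambda>i. \<bar>x $ i\<bar>) ` I) > \<gamma> * Max ((\<lambda>j. \<bar>gradient f x $ j\<bar>) ` (- supp x)))"

text \<open>
  The ratio bound is stated in product form so that it also covers sequences that reach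
  the limit after finitely many steps.
\<close>

definition Q_linearly_converges :: "(nat \<Rightarrow> 'a::real_normed_vector) \<Rightarrow> 'a \<Rightarrow> bool" where
  "Q_linearly_converges X l \<longleftrightarrow> X \<longlonglongrightarrow> l \<and>
     (\<exists>q. 0 < q \<and> q < 1 \<and>
        (\<forall>\<^sub>F k in sequentially. norm (X (Suc k) - l) \<le> q * norm (X k - l)))"

end

theory Submission
  imports Defs
begin

text \<open>
  Put \<open>J = supp xstar\<close>.  Strict HT-stability forces \<open>card J = s\<close> and leaves a gap between the
  entries of \<open>xstar - \<gamma> \<nabla>f(xstar)\<close> on \<open>J\<close> and those off \<open>J\<close>.  By continuity of the gradient the
  gap survives near \<open>xstar\<close>, and so does the nonvanishing of the entries on \<open>J\<close>.  Hence close to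
  \<open>xstar\<close> a sparse vector already lies in the subspace of vectors supported in \<open>J\<close>, hard
  thresholding selects exactly \<open>J\<close> (lemma \<open>hard_threshold_eq_coord_proj\<close>), and IHT is plain
  gradient descent on this subspace.

  On the subspace \<open>f\<close> is convex and \<open>xstar\<close> is its minimizer.  Write
  \<open>D = f xstar - f x - \<nabla>f(x) \<bullet> (xstar - x)\<close> for the Bregman divergence.  Expanding the square of
  the new distance and bounding the gradient by the decrease of \<open>f\<close>, which the smoothness
  inequality guarantees when \<open>\<gamma> \<le> 1 / L\<close>, a step \<open>x \<mapsto> x'\<close> satisfies
  \<open>norm (x' - xstar)\<^sup>2 \<le> norm (x - xstar)\<^sup>2 - 2 \<gamma> D\<close> (lemma \<open>gradient_step_distance\<close>).
  Strict convexity makes \<open>D\<close> positive away from \<open>xstar\<close>.  So the distance to \<open>xstar\<close> drops at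
  every step from another point: the iterates never leave the ball in which they started, so that the local
  description stays valid, and by compactness they converge (lemma
  \<open>strictly_approaching_iterates_converge\<close>).  Strong convexity gives
  \<open>D \<ge> \<mu> / 2 * norm (x - xstar)\<^sup>2\<close>, and the distance contracts by a fixed factor.
\<close>

section \<open>Coordinate projections and hard thresholding\<close>

definition coord_proj :: "'n::finite set \<Rightarrow> real^'n \<Rightarrow> real^'n" where
  "coord_proj J x = (\<chi> i. if i \<in> J then x $ i else 0)"

lemma coord_proj_nth [simp]: "coord_proj J x $ i = (if i \<in> J then x $ i else 0)"
  by (simp add: coord_proj_def)

lemma coord_proj_in_coord_subspace: "coord_proj J x \<in> coord_subspace J"
  by (simp add: coord_subspace_def)

lemma coord_proj_self: "x \<in> coord_subspace J \<Longrightarrow> coord_proj J x = x"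
  by (auto simp: coord_subspace_def vec_eq_iff)

lemma linear_coord_proj: "linear (coord_proj J)"
  by (rule linearI) (auto simp: vec_eq_iff)

lemma inner_coord_proj:
  assumes "v \<in> coord_subspace J"
  shows "coord_proj J x \<bullet> v = x \<bullet> v"
  using assms by (auto simp: inner_vec_def coord_subspace_def intro!: sum.cong)

lemma subspace_coord_subspace: "subspace (coord_subspace J)"
  by (auto simp: subspace_def coord_subspace_def)

lemma coord_subspace_subset_sparse_set:
  assumes "card J \<le> s"
  shows "coord_subspace J \<subseteq> sparse_set s"
proof
  fix x assume "x \<in> coord_subspace J"
  then have "supp x \<subseteq> J" by (auto simp: coord_subspace_def supp_def)
  then show "x \<in> sparse_set s"
    using assms card_mono[of J "supp x"] by (auto simp: sparse_set_def l0norm_def)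
qed

lemma sparse_set_supp_supset:
  assumes "x \<in> sparse_set (card J)" and "J \<subseteq> supp x"
  shows "x \<in> coord_subspace J"
proof -
  have "J = supp x"
    using assms by (intro card_seteq) (auto simp: sparse_set_def l0norm_def)
  then show ?thesis by (auto simp: coord_subspace_def supp_def)
qed

lemma norm_power2_vec: "(norm (x :: real^'n::finite))\<^sup>2 = (\<Sum>i\<in>UNIV. (x $ i)\<^sup>2)"
  unfolding power2_norm_eq_inner by (simp add: inner_vec_def power2_eq_square)

text \<open>
  A competitor with support \<open>K \<noteq> J\<close> pays for the entries in \<open>J - K\<close>, all above \<open>c\<close>, and saves
  at most those in \<open>K - J\<close>, which are no more numerous and are bounded by \<open>c\<close>.
\<close>

lemma hard_threshold_eq_coord_proj:
  fixes w :: "real^'n::finite"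
  assumes large: "\<And>i. i \<in> J \<Longrightarrow> c < \<bar>w $ i\<bar>"
    and small: "\<And>j. j \<notin> J \<Longrightarrow> \<bar>w $ j\<bar> \<le> c"
    and "0 \<le> c"
    and z: "z \<in> hard_threshold (card J) w"
  shows "z = coord_proj J w"
proof -
  define K where "K = supp z"
  let ?S = "\<lambda>A. \<Sum>i\<in>A. (w $ i)\<^sup>2"
  have cardK: "card K \<le> card J" and opt: "\<And>y. l0norm y \<le> card J \<Longrightarrow> norm (z - w) \<le> norm (y - w)"
    using z by (auto simp: hard_threshold_def is_arg_min_linorder K_def l0norm_def)
  have "l0norm (coord_proj J w) \<le> card J"
    using coord_subspace_subset_sparse_set[of J "card J"] coord_proj_in_coord_subspace
    by (auto simp: sparse_set_def)
  then have "(norm (z - w))\<^sup>2 \<le> (norm (coord_proj J w - w))\<^sup>2"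
    using opt by (intro power_mono) auto
  moreover have "(norm (coord_proj J w - w))\<^sup>2 = ?S (- J)"
    unfolding norm_power2_vec by (rule sum.mono_neutral_cong_right) auto
  moreover have "(norm (z - w))\<^sup>2 = (\<Sum>i\<in>K. (z $ i - w $ i)\<^sup>2) + ?S (- K)"
  proof -
    have "(norm (z - w))\<^sup>2 = (\<Sum>i\<in>K. (z $ i - w $ i)\<^sup>2) + (\<Sum>i\<in>- K. (z $ i - w $ i)\<^sup>2)"
      unfolding norm_power2_vec by (subst sum.union_disjoint[symmetric]) auto
    also have "(\<Sum>i\<in>- K. (z $ i - w $ i)\<^sup>2) = ?S (- K)"
      by (rule sum.cong) (auto simp: K_def supp_def)
    finally show ?thesis .
  qed
  moreover have "?S (- K) = ?S (J - K) + ?S (- (J \<union> K))"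
    by (subst sum.union_disjoint[symmetric]) (auto intro!: sum.cong)
  moreover have "?S (- J) = ?S (K - J) + ?S (- (J \<union> K))"
    by (subst sum.union_disjoint[symmetric]) (auto intro!: sum.cong)
  ultimately have key: "(\<Sum>i\<in>K. (z $ i - w $ i)\<^sup>2) + ?S (J - K) \<le> ?S (K - J)"
    by linarith
  have "J \<subseteq> K"
  proof (rule ccontr)
    assume "\<not> J \<subseteq> K"
    then have ne: "J - K \<noteq> {}" by blast
    have "?S (K - J) \<le> (\<Sum>i\<in>K - J. c\<^sup>2)"
      using small \<open>0 \<le> c\<close> by (intro sum_mono) (auto simp: abs_le_square_iff[symmetric])
    also have "\<dots> \<le> (\<Sum>i\<in>J - K. c\<^sup>2)"
    proof -
      have "card (K - J) \<le> card (J - K)"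
        using cardK by (simp add: card_le_sym_Diff)
      then show ?thesis by (auto intro!: mult_right_mono)
    qed
    also have "\<dots> < ?S (J - K)"
    proof (rule sum_strict_mono)
      fix i assume "i \<in> J - K"
      then show "c\<^sup>2 < (w $ i)\<^sup>2"
        using large[of i] \<open>0 \<le> c\<close> power_strict_mono[of c "\<bar>w $ i\<bar>" 2] by simp
    qed (use ne in auto)
    finally show False
      using key sum_nonneg[of K "\<lambda>i. (z $ i - w $ i)\<^sup>2"] by simp
  qed
  then have "K = J"
    using cardK by (metis card_seteq finite)
  then have "(\<Sum>i\<in>J. (z $ i - w $ i)\<^sup>2) \<le> 0" using key by simp
  then have "\<forall>i\<in>J. (z $ i - w $ i)\<^sup>2 = 0"
    by (metis (no_types, lifting) antisym finite sum_nonneg sum_nonneg_eq_0_iff zero_le_power2)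
  then show ?thesis
    using \<open>K = J\<close> by (auto simp: vec_eq_iff K_def supp_def)
qed

text \<open>
  The maximum is nonnegative because fewer than \<open>CARD('n)\<close> entries are nonzero; thus all \<open>s\<close> top
  entries are nonzero and exhaust the support.
\<close>

lemma strictly_HT_stable_gap:
  fixes f :: "real^'n::finite \<Rightarrow> real"
  assumes "strictly_HT_stable s f \<gamma> x" and "s < CARD('n)"
  obtains c where "card (supp x) = s" and "0 \<le> c" and "\<And>i. i \<in> supp x \<Longrightarrow> c < \<bar>x $ i\<bar>"
    and "\<And>j. j \<notin> supp x \<Longrightarrow> \<gamma> * \<bar>gradient f x $ j\<bar> < c"
proof -
  let ?G = "(\<lambda>j. \<bar>gradient f x $ j\<bar>) ` (- supp x)"
  obtain I where pos: "\<gamma> > 0" and sp: "card (supp x) \<le> s" and I: "card I = s"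
    and gap: "\<gamma> * Max ?G < Min ((\<lambda>i. \<bar>x $ i\<bar>) ` I)"
    using assms(1) by (auto simp: strictly_HT_stable_def top_indices_def sparse_set_def l0norm_def)
  have "supp x \<noteq> UNIV" using sp assms(2) by auto
  then obtain j0 where "j0 \<notin> supp x" by blast
  then have "\<bar>gradient f x $ j0\<bar> \<le> Max ?G" by (intro Max_ge) auto
  then have Max0: "0 \<le> Max ?G" by linarith
  obtain c where c: "\<gamma> * Max ?G < c" "c < Min ((\<lambda>i. \<bar>x $ i\<bar>) ` I)"
    using dense[OF gap] by blast
  have "0 \<le> \<gamma> * Max ?G" using Max0 pos by simp
  then have c0: "0 \<le> c" using c(1) by linarith
  have large: "c < \<bar>x $ i\<bar>" if "i \<in> I" for i
  proof -
    have "Min ((\<lambda>i. \<bar>x $ i\<bar>) ` I) \<le> \<bar>x $ i\<bar>" using that by (intro Min_le) auto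
    then show ?thesis using c(2) by linarith
  qed
  then have "I \<subseteq> supp x" using c0 by (fastforce simp: supp_def)
  then have "I = supp x" using I sp by (simp add: card_seteq)
  moreover have "\<gamma> * \<bar>gradient f x $ j\<bar> < c" if "j \<notin> supp x" for j
  proof -
    have "\<bar>gradient f x $ j\<bar> \<le> Max ?G" using that by (intro Max_ge) auto
    then have "\<gamma> * \<bar>gradient f x $ j\<bar> \<le> \<gamma> * Max ?G" using pos by simp
    then show ?thesis using c(1) by linarith
  qed
  ultimately show ?thesis using that[of c] I c0 large by simp
qed

section \<open>First-order consequences of convexity\<close>

text \<open>
  The defect \<open>m * u * v\<close> is zero for plain convexity and \<open>m = \<mu> / 2 * (norm (x - y))\<^sup>2\<close> for strong
  convexity.  Along the segment the difference quotients at \<open>x\<close> are at most \<open>f y - f x - m * u\<close>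
  with \<open>u \<rightarrow> 1\<close>.
\<close>

lemma convex_segment_gradient_bound:
  fixes f :: "'a::euclidean_space \<Rightarrow> real"
  assumes diff: "f differentiable (at x)"
    and conv: "\<And>u v. 0 < u \<Longrightarrow> 0 < v \<Longrightarrow> u + v = 1 \<Longrightarrow>
      f (u *\<^sub>R x + v *\<^sub>R y) \<le> u * f x + v * f y - m * u * v"
  shows "f x + gradient f x \<bullet> (y - x) + m \<le> f y"
proof -
  let ?h = "\<lambda>t::real. f (x + t *\<^sub>R (y - x))"
  have "(f has_derivative (\<lambda>d. d \<bullet> gradient f x)) (at (x + 0 *\<^sub>R (y - x)))"
    using GDERIV_gradient[OF diff] by (simp add: gderiv_def)
  moreover have "((\<lambda>t::real. x + t *\<^sub>R (y - x)) has_derivative (\<lambda>t. t *\<^sub>R (y - x))) (at 0)"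
    by (auto intro!: derivative_eq_intros)
  ultimately have "(?h has_derivative (\<lambda>t. (t *\<^sub>R (y - x)) \<bullet> gradient f x)) (at 0)"
    by (rule has_derivative_compose[rotated])
  then have "(?h has_field_derivative gradient f x \<bullet> (y - x)) (at 0)"
    by (simp add: has_field_derivative_def inner_commute mult.commute[of _ "_ \<bullet> _"])
  then have "((\<lambda>t. (?h t - ?h 0) / t) \<longlongrightarrow> gradient f x \<bullet> (y - x)) (at_right 0)"
    using has_field_derivative_at_within[of ?h _ 0 "{0<..}"] by (simp add: has_field_derivative_iff)
  moreover have "((\<lambda>t::real. f y - f x - m * (1 - t)) \<longlongrightarrow> f y - f x - m * (1 - 0)) (at_right 0)"
    by (intro tendsto_intros)
  moreover have "\<forall>\<^sub>F t in at_right 0. (?h t - ?h 0) / t \<le> f y - f x - m * (1 - t)"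
  proof -
    have "\<forall>\<^sub>F t::real in at_right 0. 0 < t \<and> t < 1"
      using eventually_at_right_real[of 0 1] by (auto elim: eventually_mono)
    then show ?thesis
    proof eventually_elim
      case (elim t)
      have "x + t *\<^sub>R (y - x) = (1 - t) *\<^sub>R x + t *\<^sub>R y" by (simp add: algebra_simps)
      then have "?h t - ?h 0 \<le> t * (f y - f x - m * (1 - t))"
        using conv[of "1 - t" t] elim by (simp add: algebra_simps)
      then show ?case using elim by (simp add: divide_le_eq mult.commute)
    qed
  qed
  ultimately have "gradient f x \<bullet> (y - x) \<le> f y - f x - m * (1 - 0)"
    by (intro tendsto_le[OF trivial_limit_at_right_real])
  then show ?thesis by simp
qed

lemma strictly_convex_gradient_bound_less:
  fixes f :: "'a::euclidean_space \<Rightarrow> real"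
  assumes sc: "strictly_convex_on S f" and diff: "f differentiable (at x)"
    and xy: "x \<in> S" "y \<in> S" "x \<noteq> y"
  shows "f x + gradient f x \<bullet> (y - x) < f y"
proof -
  have le: "f x + gradient f x \<bullet> (b - x) \<le> f b" if "b \<in> S" "x \<noteq> b" for b
    using convex_segment_gradient_bound[OF diff, of b 0] sc xy(1) that
    by (fastforce simp: strictly_convex_on_def intro: less_imp_le)
  (* the non-strict bound at the midpoint, where f lies strictly below the chord *)
  let ?b = "(1/2) *\<^sub>R x + (1/2) *\<^sub>R y"
  have less: "f ?b < 1/2 * f x + 1/2 * f y"
    using sc xy unfolding strictly_convex_on_def by (metis field_sum_of_halves half_gt_zero_iff zero_less_one)
  have bx: "?b - x = (1/2) *\<^sub>R (y - x)"
  proof -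
    have "?b - x = ?b - ((1/2) *\<^sub>R x + (1/2) *\<^sub>R x)"
      by (simp flip: scaleR_left_distrib)
    then show ?thesis by (simp add: scaleR_diff_right)
  qed
  have "?b \<in> S"
    using sc xy unfolding strictly_convex_on_def by (intro convexD) auto
  moreover have "x \<noteq> ?b" using bx xy(3) by auto
  ultimately have "f x + gradient f x \<bullet> (?b - x) \<le> f ?b" by (rule le)
  then have "f x + 1/2 * (gradient f x \<bullet> (y - x)) \<le> f ?b" by (simp add: bx)
  then show ?thesis using less by linarith
qed

lemma strictly_convex_imp_minimizer:
  fixes f :: "'a::euclidean_space \<Rightarrow> real"
  assumes "strictly_convex_on S f" and "f differentiable (at x)" and "x \<in> S"
    and "\<And>y. y \<in> S \<Longrightarrow> gradient f x \<bullet> (y - x) = 0" and "y \<in> S"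
  shows "f x \<le> f y"
  using strictly_convex_gradient_bound_less[OF assms(1,2,3,5)] assms(4)[OF assms(5)]
  by (cases "x = y") auto

lemma strongly_convex_gradient_bound:
  fixes f :: "'a::euclidean_space \<Rightarrow> real"
  assumes sc: "strongly_convex_on S f" and diff: "\<And>x. f differentiable (at x)"
  obtains \<mu> where "0 < \<mu>" and
    "\<And>x y. x \<in> S \<Longrightarrow> y \<in> S \<Longrightarrow>
      f x + gradient f x \<bullet> (y - x) + \<mu> / 2 * (norm (x - y))\<^sup>2 \<le> f y"
proof -
  obtain \<mu> where \<mu>: "\<mu> > 0" and
    conv: "\<And>x y u v. \<lbrakk>x \<in> S; y \<in> S; 0 \<le> u; 0 \<le> v; u + v = 1\<rbrakk> \<Longrightarrow>
      f (u *\<^sub>R x + v *\<^sub>R y) \<le> u * f x + v * f y - \<mu> / 2 * u * v * (norm (x - y))\<^sup>2"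
    using sc unfolding strongly_convex_on_def by blast
  show ?thesis
  proof (rule that[OF \<mu>])
    fix x y assume xy: "x \<in> S" "y \<in> S"
    show "f x + gradient f x \<bullet> (y - x) + \<mu> / 2 * (norm (x - y))\<^sup>2 \<le> f y"
    proof (rule convex_segment_gradient_bound[OF diff])
      fix u v :: real assume "0 < u" "0 < v" "u + v = 1"
      then show "f (u *\<^sub>R x + v *\<^sub>R y) \<le> u * f x + v * f y - \<mu> / 2 * (norm (x - y))\<^sup>2 * u * v"
        using conv[OF xy, of u v] by (simp add: mult_ac)
    qed
  qed
qed

section \<open>Gradient descent on a coordinate subspace\<close>

definition coord_gradient_step ::
  "'n::finite set \<Rightarrow> (real^'n \<Rightarrow> real) \<Rightarrow> real \<Rightarrow> real^'n \<Rightarrow> real^'n" where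
  "coord_gradient_step J f \<gamma> x = coord_proj J (x - \<gamma> *\<^sub>R gradient f x)"

lemma coord_gradient_step_in_coord_subspace: "coord_gradient_step J f \<gamma> x \<in> coord_subspace J"
  by (simp add: coord_gradient_step_def coord_proj_in_coord_subspace)

lemma coord_gradient_step_eq:
  assumes "x \<in> coord_subspace J"
  shows "coord_gradient_step J f \<gamma> x = x - \<gamma> *\<^sub>R coord_proj J (gradient f x)"
  using assms unfolding coord_gradient_step_def
  by (simp add: linear_diff[OF linear_coord_proj] linear_scale[OF linear_coord_proj] coord_proj_self)

lemma continuous_on_coord_gradient_step:
  assumes "continuous_on S (gradient f)"
  shows "continuous_on S (coord_gradient_step J f \<gamma>)"
  unfolding coord_gradient_step_def
  by (rule linear_continuous_on_compose[OF _ linear_coord_proj]) (intro continuous_intros assms)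

text \<open>
  With \<open>g\<close> the projected gradient, the new squared distance is
  \<open>norm (x - l)\<^sup>2 - 2 \<gamma> g \<bullet> (x - l) + \<gamma>\<^sup>2 norm g\<^sup>2\<close>.  The inner product equals \<open>f x - f l\<close> plus the
  Bregman divergence, and the smoothness inequality at the new point together with the minimality
  of \<open>l\<close> gives \<open>\<gamma>\<^sup>2 norm g\<^sup>2 \<le> 2 \<gamma> (f x - f l)\<close>; the two function gaps cancel.
\<close>

lemma gradient_step_distance:
  fixes f :: "real^'n::finite \<Rightarrow> real"
  assumes \<gamma>: "0 \<le> \<gamma>" "\<gamma> * L \<le> 1"
    and smooth: "\<And>y. y \<in> coord_subspace J \<Longrightarrow>
      f y \<le> f x + gradient f x \<bullet> (y - x) + L / 2 * (norm (y - x))\<^sup>2"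
    and min: "\<And>y. y \<in> coord_subspace J \<Longrightarrow> f l \<le> f y"
    and x: "x \<in> coord_subspace J" and l: "l \<in> coord_subspace J"
  shows "(norm (coord_gradient_step J f \<gamma> x - l))\<^sup>2
    \<le> (norm (x - l))\<^sup>2 - 2 * \<gamma> * (f l - f x - gradient f x \<bullet> (l - x))"
proof -
  define g where "g = coord_proj J (gradient f x)"
  let ?x' = "coord_gradient_step J f \<gamma> x"
  have x': "?x' = x - \<gamma> *\<^sub>R g" and x'V: "?x' \<in> coord_subspace J"
    using coord_gradient_step_eq[OF x, of f \<gamma>] coord_gradient_step_in_coord_subspace[of J f \<gamma> x]
    by (simp_all only: g_def)
  have inner_g: "gradient f x \<bullet> v = g \<bullet> v" if "v \<in> coord_subspace J" for v
    using inner_coord_proj[OF that] by (simp add: g_def)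
  have gV: "g \<in> coord_subspace J" by (simp add: g_def coord_proj_in_coord_subspace)
  have "f l \<le> f ?x'" using min x'V by blast
  also have "\<dots> \<le> f x + gradient f x \<bullet> (?x' - x) + L / 2 * (norm (?x' - x))\<^sup>2"
    using smooth x'V by blast
  also have "\<dots> = f x - \<gamma> * (norm g)\<^sup>2 + L / 2 * \<gamma>\<^sup>2 * (norm g)\<^sup>2"
    using inner_g[OF gV] by (simp add: x' power_mult_distrib power2_norm_eq_inner)
  also have "\<dots> \<le> f x - \<gamma> / 2 * (norm g)\<^sup>2"
  proof -
    have "\<gamma> * L * (\<gamma> * (norm g)\<^sup>2) \<le> 1 * (\<gamma> * (norm g)\<^sup>2)"
      using \<gamma> by (intro mult_right_mono) auto
    then show ?thesis by (simp add: power2_eq_square algebra_simps)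
  qed
  finally have "2 * \<gamma> * (\<gamma> / 2 * (norm g)\<^sup>2) \<le> 2 * \<gamma> * (f x - f l)"
    using \<gamma>(1) by (intro mult_left_mono) auto
  then have decrease: "\<gamma>\<^sup>2 * (norm g)\<^sup>2 \<le> 2 * \<gamma> * (f x - f l)"
    by (simp add: power2_eq_square algebra_simps)
  have "l - x \<in> coord_subspace J"
    using l x by (intro subspace_diff subspace_coord_subspace)
  then have "gradient f x \<bullet> (l - x) = g \<bullet> (l - x)" by (rule inner_g)
  then have D: "gradient f x \<bullet> (l - x) = - (g \<bullet> (x - l))"
    by (simp add: inner_diff_right)
  have "(norm (?x' - l))\<^sup>2 = (norm ((x - l) - \<gamma> *\<^sub>R g))\<^sup>2"
    by (simp add: x' algebra_simps)
  also have "\<dots> = (norm (x - l))\<^sup>2 - 2 * \<gamma> * (g \<bullet> (x - l)) + \<gamma>\<^sup>2 * (norm g)\<^sup>2"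
    unfolding power2_norm_eq_inner
    by (simp add: inner_diff_left inner_diff_right inner_commute power2_eq_square algebra_simps)
  finally show ?thesis unfolding D using decrease by (simp add: right_diff_distrib distrib_left)
qed

section \<open>Iterations that strictly approach a point\<close>

text \<open>
  The distances \<open>dist (X k) l\<close> decrease to some \<open>d\<close>.  At a cluster point \<open>y\<close> of the iterates
  both \<open>y\<close> and \<open>T y\<close> have distance \<open>d\<close> from \<open>l\<close>, so \<open>y = l\<close> and \<open>d = 0\<close>.
\<close>

lemma strictly_approaching_iterates_converge:
  fixes T :: "'a::heine_borel \<Rightarrow> 'a"
  assumes "closed S" and cont: "continuous_on S T"
    and fixpoint: "T l = l"
    and approach: "\<And>x. x \<in> S \<Longrightarrow> x \<noteq> l \<Longrightarrow> dist (T x) l < dist x l"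
    and X: "\<And>k. X k \<in> S" "\<And>k. X (Suc k) = T (X k)"
  shows "X \<longlonglongrightarrow> l"
proof -
  have dec: "decseq (\<lambda>k. dist (X k) l)"
    unfolding decseq_Suc_iff
    by (metis X approach fixpoint less_imp_le order_refl)
  then obtain d where d: "(\<lambda>k. dist (X k) l) \<longlonglongrightarrow> d"
    using decseq_convergent[OF dec, of 0] by auto
  have "compact (S \<inter> cball l (dist (X 0) l))"
    using \<open>closed S\<close> by (simp add: closed_Int_compact)
  moreover have "X k \<in> S \<inter> cball l (dist (X 0) l)" for k
    using X(1) decseqD[OF dec, of 0 k] by (simp add: dist_commute)
  ultimately obtain y r where y: "y \<in> S" and r: "strict_mono r" and lim: "(X \<circ> r) \<longlonglongrightarrow> y"
    unfolding compact_def by (metis IntD1)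
  have "(\<lambda>k. dist ((X \<circ> r) k) l) \<longlonglongrightarrow> dist y l"
    by (intro tendsto_intros lim)
  moreover have "(\<lambda>k. dist ((X \<circ> r) k) l) \<longlonglongrightarrow> d"
    using LIMSEQ_subseq_LIMSEQ[OF d r] by (simp add: o_def)
  ultimately have d_y: "d = dist y l" by (rule LIMSEQ_unique[rotated])
  have "(\<lambda>k. T ((X \<circ> r) k)) \<longlonglongrightarrow> T y"
    by (rule continuous_on_tendsto_compose[OF cont lim y]) (simp add: X(1))
  then have "(\<lambda>k. dist (T ((X \<circ> r) k)) l) \<longlonglongrightarrow> dist (T y) l"
    by (intro tendsto_intros)
  moreover have "(\<lambda>k. dist (T ((X \<circ> r) k)) l) \<longlonglongrightarrow> d"
    using LIMSEQ_subseq_LIMSEQ[OF LIMSEQ_Suc[OF d] r] X(2) by (simp add: o_def)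
  ultimately have "d = dist (T y) l" by (rule LIMSEQ_unique[rotated])
  then have "y = l" using approach[OF y] d_y by fastforce
  then have "(\<lambda>k. dist (X k) l) \<longlonglongrightarrow> 0" using d d_y by simp
  then show ?thesis by (rule tendsto_dist_iff[THEN iffD2])
qed

section \<open>Local convergence of iterative hard thresholding\<close>

theorem proposition1:
  fixes f :: "real^'n::finite \<Rightarrow> real"
    and s :: nat and L \<gamma> :: real and xstar :: "real^'n"
  assumes s: "1 \<le> s" "s < CARD('n)"
    and rss: "RSS s L f"
    and C1: "C1_function f"
    and bdd: "bdd_below (f ` sparse_set s)"
    and strict: "\<And>J :: 'n set. card J = s \<Longrightarrow> strictly_convex_on (coord_subspace J) f"
    and \<gamma>: "0 < \<gamma>" "\<gamma> \<le> 1 / L"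
    and stable: "strictly_HT_stable s f \<gamma> xstar"
  shows "\<exists>B. open B \<and> xstar \<in> B \<and>
    (\<forall>x0 \<in> B \<inter> sparse_set s. \<forall>X. IHT_sequence s f \<gamma> x0 X \<longrightarrow> X \<longlonglongrightarrow> xstar) \<and>
    ((\<forall>J :: 'n set. card J = s \<longrightarrow> strongly_convex_on (coord_subspace J) f) \<longrightarrow>
      (\<forall>x0 \<in> B \<inter> sparse_set s. \<forall>X. IHT_sequence s f \<gamma> x0 X \<longrightarrow> Q_linearly_converges X xstar))"
proof -
  define J where "J = supp xstar"
  define V where "V = coord_subspace J"
  define T where "T = coord_gradient_step J f \<gamma>"
  define w where "w = (\<lambda>x. x - \<gamma> *\<^sub>R gradient f x)"
  obtain c where cardJ: "card J = s" and c0: "0 \<le> c"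
    and large: "\<And>i. i \<in> J \<Longrightarrow> c < \<bar>xstar $ i\<bar>"
    and small: "\<And>j. j \<notin> J \<Longrightarrow> \<gamma> * \<bar>gradient f xstar $ j\<bar> < c"
    using strictly_HT_stable_gap[OF stable s(2)] unfolding J_def by blast
  have diff: "\<And>x. f differentiable (at x)" and cont: "continuous_on UNIV (gradient f)"
    using C1 by (auto simp: C1_function_def)
  have "L > 0" using rss by (simp add: RSS_def)
  then have \<gamma>L: "\<gamma> * L \<le> 1" using \<gamma>(2) by (simp add: pos_le_divide_eq)
  have xsV: "xstar \<in> V" by (auto simp: V_def J_def coord_subspace_def supp_def)
  have convV: "strictly_convex_on V f" using strict[OF cardJ] by (simp add: V_def)
  have stat: "gradient f xstar $ i = 0" if "i \<in> J" for i
    using stable that by (simp add: strictly_HT_stable_def J_def)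
  then have proj0: "coord_proj J (gradient f xstar) = 0"
    by (simp add: vec_eq_iff)
  have fixpoint: "T xstar = xstar"
    using coord_gradient_step_eq[of xstar J f \<gamma>] xsV proj0 by (simp add: T_def V_def)
  have "gradient f xstar \<bullet> (y - xstar) = 0" if "y \<in> V" for y
    using inner_coord_proj[of "y - xstar" J "gradient f xstar"] proj0 that xsV
    by (simp add: V_def subspace_diff[OF subspace_coord_subspace])
  then have min: "f xstar \<le> f y" if "y \<in> V" for y
    using strictly_convex_imp_minimizer[OF convV diff xsV] that by blast
  have Vsparse: "V \<subseteq> sparse_set s"
    using coord_subspace_subset_sparse_set[of J s] cardJ by (simp add: V_def)
  have TV: "T x \<in> V" for x
    by (simp add: T_def V_def coord_gradient_step_in_coord_subspace)
  have step: "(norm (T x - xstar))\<^sup>2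
      \<le> (norm (x - xstar))\<^sup>2 - 2 * \<gamma> * (f xstar - f x - gradient f x \<bullet> (xstar - x))"
    if "x \<in> V" for x
    unfolding T_def
  proof (rule gradient_step_distance)
    show "f y \<le> f x + gradient f x \<bullet> (y - x) + L / 2 * (norm (y - x))\<^sup>2"
      if "y \<in> coord_subspace J" for y
      using rss Vsparse \<open>x \<in> V\<close> that by (auto simp: RSS_def V_def)
  qed (use \<gamma> \<gamma>L min xsV that in \<open>auto simp: V_def\<close>)
  have approach: "dist (T x) xstar < dist x xstar" if "x \<in> V" "x \<noteq> xstar" for x
  proof -
    have "f x + gradient f x \<bullet> (xstar - x) < f xstar"
      using strictly_convex_gradient_bound_less[OF convV diff] that xsV by blast
    then have "0 < 2 * \<gamma> * (f xstar - f x - gradient f x \<bullet> (xstar - x))"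
      using \<gamma>(1) by simp
    then have "(norm (T x - xstar))\<^sup>2 < (norm (x - xstar))\<^sup>2"
      using step[OF that(1)] by linarith
    then show ?thesis by (simp add: dist_norm power_less_imp_less_base)
  qed

  (* on U sparse vectors lie in V, and hard thresholding after a gradient step selects J *)
  define U where "U = (\<Inter>i\<in>J. {x. c < \<bar>w x $ i\<bar>} \<inter> {x. x $ i \<noteq> 0}) \<inter> (\<Inter>j\<in>- J. {x. \<bar>w x $ j\<bar> < c})"
  have contw: "continuous_on UNIV (\<lambda>x. \<bar>w x $ i\<bar>)" for i
    unfolding w_def by (intro continuous_intros cont)
  have "open U"
    unfolding U_def
    by (intro open_Int open_INT finite ballI open_Collect_less open_Collect_neq continuous_intros contw)
  moreover have "xstar \<in> U"
    using large small stat \<gamma>(1) c0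
    by (fastforce simp: U_def w_def J_def supp_def abs_mult)
  ultimately obtain \<epsilon> where \<epsilon>: "\<epsilon> > 0" "ball xstar \<epsilon> \<subseteq> U"
    by (meson open_contains_ball)

  have iterates: "X k \<in> V \<inter> ball xstar \<epsilon> \<and> X (Suc k) = T (X k)"
    if x0: "x0 \<in> ball xstar \<epsilon> \<inter> sparse_set s" and IHT: "IHT_sequence s f \<gamma> x0 X" for x0 X k
  proof -
    have local: "X (Suc k) = T (X k)" if "X k \<in> ball xstar \<epsilon>" for k
    proof -
      have "X k \<in> U" using that \<epsilon>(2) by blast
      moreover have "X (Suc k) \<in> hard_threshold (card J) (w (X k))"
        using IHT by (simp add: IHT_sequence_def cardJ w_def)
      ultimately have "X (Suc k) = coord_proj J (w (X k))"
        using c0 by (intro hard_threshold_eq_coord_proj[of J c]) (auto simp: U_def less_imp_le)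
      then show ?thesis by (simp add: T_def coord_gradient_step_def w_def)
    qed
    have "X k \<in> V \<inter> ball xstar \<epsilon>"
    proof (induction k)
      case 0
      have "x0 \<in> U" using x0 \<epsilon>(2) by blast
      then have "J \<subseteq> supp x0" by (auto simp: U_def supp_def)
      then have "x0 \<in> V"
        using sparse_set_supp_supset x0 cardJ by (auto simp: V_def)
      then show ?case using x0 IHT by (simp add: IHT_sequence_def)
    next
      case (Suc k)
      then have "dist (T (X k)) xstar \<le> dist (X k) xstar"
        using approach[of "X k"] fixpoint by fastforce
      then show ?case using Suc local[of k] TV by (auto simp: dist_commute)
    qed
    then show ?thesis using local by blast
  qed

  have conv: "X \<longlonglongrightarrow> xstar"
    if "x0 \<in> ball xstar \<epsilon> \<inter> sparse_set s" "IHT_sequence s f \<gamma> x0 X" for x0 X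
  proof (rule strictly_approaching_iterates_converge)
    show "closed V" unfolding V_def by (intro closed_subspace subspace_coord_subspace)
    show "continuous_on V T"
      unfolding T_def using cont continuous_on_subset
      by (intro continuous_on_coord_gradient_step) blast
  qed (use fixpoint approach iterates[OF that] in auto)

  have Qlin: "Q_linearly_converges X xstar"
    if sc: "strongly_convex_on V f"
      and x0: "x0 \<in> ball xstar \<epsilon> \<inter> sparse_set s" and IHT: "IHT_sequence s f \<gamma> x0 X" for x0 X
  proof -
    obtain \<mu> where \<mu>: "0 < \<mu>" and bound: "\<And>x y. x \<in> V \<Longrightarrow> y \<in> V \<Longrightarrow>
        f x + gradient f x \<bullet> (y - x) + \<mu> / 2 * (norm (x - y))\<^sup>2 \<le> f y"
      using strongly_convex_gradient_bound[OF sc diff] by blast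
    (* the maximum with 1/2 keeps the factor positive, as Q-linear convergence asks *)
    define q where "q = sqrt (max (1 - \<gamma> * \<mu>) (1 / 2))"
    have q: "0 < q" "q < 1" "1 - \<gamma> * \<mu> \<le> q\<^sup>2"
      using \<gamma>(1) \<mu> by (auto simp: q_def)
    have "norm (X (Suc k) - xstar) \<le> q * norm (X k - xstar)" for k
    proof -
      have Xk: "X k \<in> V" and Xs: "X (Suc k) = T (X k)"
        using iterates[OF x0 IHT] by auto
      have "\<mu> / 2 * (norm (X k - xstar))\<^sup>2
          \<le> f xstar - f (X k) - gradient f (X k) \<bullet> (xstar - X k)"
        using bound[OF Xk xsV] by linarith
      then have "2 * \<gamma> * (\<mu> / 2 * (norm (X k - xstar))\<^sup>2)
          \<le> 2 * \<gamma> * (f xstar - f (X k) - gradient f (X k) \<bullet> (xstar - X k))"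
        using \<gamma>(1) by (intro mult_left_mono) auto
      then have "(norm (X (Suc k) - xstar))\<^sup>2 \<le> (1 - \<gamma> * \<mu>) * (norm (X k - xstar))\<^sup>2"
        using step[OF Xk] by (simp add: Xs algebra_simps)
      also have "\<dots> \<le> q\<^sup>2 * (norm (X k - xstar))\<^sup>2"
        using q(3) by (intro mult_right_mono) auto
      finally have "(norm (X (Suc k) - xstar))\<^sup>2 \<le> (q * norm (X k - xstar))\<^sup>2"
        by (simp add: power_mult_distrib)
      then show ?thesis by (rule power2_le_imp_le) (use q(1) in simp)
    qed
    then show ?thesis
      using conv[OF x0 IHT] q by (auto simp: Q_linearly_converges_def)
  qed

  show ?thesis
    using \<epsilon>(1) conv Qlin cardJ by (intro exI[of _ "ball xstar \<epsilon>"]) (auto simp: V_def)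
qed

end
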